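(* Let $\mu\ge 1$, $0\le\gamma<1$, $-1\le B<A\le 1$, $-1\le B<0$, and let $k\ge m$ be non-negative integers. Let $\Phi_\mu(z)=z+\sum_{n=2}^\infty\vartheta_n z^{\mu n}$ and $\Psi_\mu(z)=z+\sum_{n=2}^\infty\lambda_n z^{\mu n}$ be convergent in $\mathbb U$ with $\vartheta_n\ge 0$, $\lambda_n\ge 0$, $\vartheta_n\ge\lambda_n$ for all $n\ge 2$. Let $f_1(z)=z$ and, for $n\ge2$, $$f_n(z)=z-\frac{(A-B)(1-\gamma)}{(1-B)\big((\mu n)^k\vartheta_n-(\mu n)^m\lambda_n\big)+(A-B)(1-\gamma)(\mu n)^m\lambda_n}\,z^{\mu n},$$ where the denominators are assumed non-zero. Then a function $F$ on $\mathbb U$ belongs to $\widetilde{\mathcal E}_{k,m}(\Phi_\mu,\Psi_\mu,A,B,\mu,\gamma)$ if and only if it can be expressed in the form $$F(z)=\sum_{n=1}^\infty\eta_nf_n(z)\qquad(z\in\mathbb U),$$ with the series converging in $\mathbb U$, where $\eta_n\ge0$ for all $n\ge1$ and $\sum_{n=1}^\infty\eta_n=1$.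
   Context: $\mathbb U=\{z\in\mathbb C:|z|<1\}$. For real $\mu\ge1$, powers $z^{s}$ with $s>0$ are taken with the principal branch for $z\ne0$, and equal $0$ at $z=0$. $\mathcal A_\mu$ is the class of functions $F_\mu(z)=z+\sum_{n=2}^\infty a_nz^{\mu n}$ ($a_n\in\mathbb C$) whose series converges in $\mathbb U$; $\mathcal X_\mu$ is the subclass of functions of the form $F_\mu(z)=z-\sum_{n=2}^\infty a_nz^{\mu n}$ with all $a_n\ge0$. For $F_\mu(z)=z+\sum_{n\ge2}a_nz^{\mu n}$ and $G_\mu(z)=z+\sum_{n\ge2}b_nz^{\mu n}$ the convolution is $(F_\mu*G_\mu)(z)=z+\sum_{n\ge2}a_nb_nz^{\mu n}$. For a non-negative integer $\beta$ the operator $D_\mu^\beta$ is $D_\mu^\beta F_\mu(z)=z+\sum_{n=2}^\infty(\mu n)^\beta a_nz^{\mu n}$. A function $F_\mu\in\mathcal A_\mu$ belongs to $\mathcal E_{k,m}(\Phi_\mu,\Psi_\mu,A,B,\mu,\gamma)$ if, for all $z$ with $0<|z|<1$, $(F_\mu*\Psi_\mu)(z)\neq0$, $D_\mu^m(F_\mu*\Psi_\mu)(z)\ne0$, and the quotient $q(z)=\dfrac{D_\mu^k(F_\mu*\Phi_\mu)(z)}{D_\mu^m(F_\mu*\Psi_\mu)(z)}$ satisfies $$\left|\frac{q(z)-1}{(A-B)(1-\gamma)-B\,(q(z)-1)}\right|<1,$$ with the denominator non-zero. (This is the inequality form of the subordination $q(z)\prec(1-\gamma)\frac{1+Az}{1+Bz}+\gamma$.)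 Finally $\widetilde{\mathcal E}_{k,m}(\Phi_\mu,\Psi_\mu,A,B,\mu,\gamma)=\mathcal E_{k,m}(\Phi_\mu,\Psi_\mu,A,B,\mu,\gamma)\cap\mathcal X_\mu$. *)

theory Defs
  imports "HOL-Analysis.Analysis"
begin

text \<open>
  \<open>has_mu_series \<mu> F a\<close> says \<open>F(z) = z + (\<Sum>n\<ge>2. a n z\<^sup>\<mu>\<^sup>n)\<close> with a convergent series at every point
  of the open unit disc. Only the entries \<open>a n\<close> with \<open>n \<ge> 2\<close> and the values of \<open>F\<close> inside the disc
  matter. On complex numbers \<open>powr\<close> is the principal branch, with \<open>0 powr s = 0\<close>.
\<close>

definition has_mu_series :: "real \<Rightarrow> (complex \<Rightarrow> complex) \<Rightarrow> (nat \<Rightarrow> complex) \<Rightarrow> bool" where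
  "has_mu_series \<mu> F a \<longleftrightarrow>
     (\<forall>z. norm z < 1 \<longrightarrow>
        (\<lambda>n. a (n + 2) * z powr of_real (\<mu> * real (n + 2))) sums (F z - z))"

definition class_A :: "real \<Rightarrow> (complex \<Rightarrow> complex) set" where
  "class_A \<mu> = {F. \<exists>a. has_mu_series \<mu> F a}"

definition class_X :: "real \<Rightarrow> (complex \<Rightarrow> complex) set" where
  "class_X \<mu> =
     {F. \<exists>a :: nat \<Rightarrow> real. (\<forall>n\<ge>2. 0 \<le> a n) \<and> has_mu_series \<mu> F (\<lambda>n. - of_real (a n))}"

text \<open>
  For \<open>\<mu> \<ge> 1\<close> and \<open>F \<in> class_A \<mu>\<close> the coefficients with index \<open>n \<ge> 2\<close> are uniquely determined by \<open>F\<close>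
  (on positive reals \<open>F(r) - r\<close> is a power series in \<open>r\<^sup>\<mu>\<close>), so the choice below is
  immaterial; for other \<open>F\<close> the value is unspecified.
\<close>

definition mu_coeff :: "real \<Rightarrow> (complex \<Rightarrow> complex) \<Rightarrow> nat \<Rightarrow> complex" where
  "mu_coeff \<mu> F = (SOME a. has_mu_series \<mu> F a)"

definition mu_conv ::
  "real \<Rightarrow> (complex \<Rightarrow> complex) \<Rightarrow> (complex \<Rightarrow> complex) \<Rightarrow> complex \<Rightarrow> complex" where
  "mu_conv \<mu> F G z =
     z + (\<Sum>n. mu_coeff \<mu> F (n + 2) * mu_coeff \<mu> G (n + 2) * z powr of_real (\<mu> * real (n + 2)))"

definition mu_D :: "real \<Rightarrow> nat \<Rightarrow> (complex \<Rightarrow> complex) \<Rightarrow> complex \<Rightarrow> complex" where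
  "mu_D \<mu> \<beta> F z =
     z + (\<Sum>n. of_real ((\<mu> * real (n + 2)) ^ \<beta>) * mu_coeff \<mu> F (n + 2)
                * z powr of_real (\<mu> * real (n + 2)))"

definition class_E ::
  "nat \<Rightarrow> nat \<Rightarrow> (complex \<Rightarrow> complex) \<Rightarrow> (complex \<Rightarrow> complex)
     \<Rightarrow> real \<Rightarrow> real \<Rightarrow> real \<Rightarrow> real \<Rightarrow> (complex \<Rightarrow> complex) set" where
  "class_E k m \<Phi> \<Psi> A B \<mu> \<gamma> =
     {F \<in> class_A \<mu>. \<forall>z. 0 < norm z \<and> norm z < 1 \<longrightarrow>
        mu_conv \<mu> F \<Psi> z \<noteq> 0 \<and>
        mu_D \<mu> m (mu_conv \<mu> F \<Psi>) z \<noteq> 0 \<and>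
        (let q = mu_D \<mu> k (mu_conv \<mu> F \<Phi>) z / mu_D \<mu> m (mu_conv \<mu> F \<Psi>) z;
             d = of_real ((A - B) * (1 - \<gamma>)) - of_real B * (q - 1)
         in d \<noteq> 0 \<and> norm ((q - 1) / d) < 1)}"

definition class_E_tilde ::
  "nat \<Rightarrow> nat \<Rightarrow> (complex \<Rightarrow> complex) \<Rightarrow> (complex \<Rightarrow> complex)
     \<Rightarrow> real \<Rightarrow> real \<Rightarrow> real \<Rightarrow> real \<Rightarrow> (complex \<Rightarrow> complex) set" where
  "class_E_tilde k m \<Phi> \<Psi> A B \<mu> \<gamma> = class_E k m \<Phi> \<Psi> A B \<mu> \<gamma> \<inter> class_X \<mu>"

end

theory Submission
  imports Defs "HOL-Complex_Analysis.Cauchy_Integral_Formula"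
begin

text \<open>
  Write \<open>c = (A - B) (1 - \<gamma>)\<close>, \<open>M n = (\<mu> n)\<^sup>k \<theta> n\<close>, \<open>L n = (\<mu> n)\<^sup>m l n\<close> and
  \<open>S n = (1 - B) (M n - L n) + c L n\<close>, so that \<open>f n z = z - (c / S n) z\<^sup>\<mu>\<^sup>n\<close> for \<open>n \<ge> 2\<close>. The
  theorem rests on a coefficient criterion: \<open>F(z) = z - \<Sum> a n z\<^sup>\<mu>\<^sup>n\<close> with \<open>a n \<ge> 0\<close> lies in the
  class if and only if \<open>\<Sum> S n a n \<le> c\<close>. Given the criterion, \<open>\<eta> n = S n a n / c\<close> for \<open>n \<ge> 2\<close>
  and \<open>\<eta> 1 = 1 - \<Sum>\<^sub>n\<^sub>\<ge>\<^sub>2 \<eta> n\<close> translate between coefficients and convex weights: the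
  criterion says exactly that \<open>\<eta> 1 \<ge> 0\<close>.

  For the criterion, let \<open>N = z - \<Sum> M n a n z\<^sup>\<mu>\<^sup>n\<close> and \<open>D = z - \<Sum> L n a n z\<^sup>\<mu>\<^sup>n\<close> be the
  numerator and the denominator of the quotient \<open>q\<close>. Sufficiency
  (\<open>quotient_bound_if_coefficient_bound\<close>) is the triangle inequality applied to
  \<open>|N - D| < |c D - B (N - D)|\<close>, the defining inequality with the fractions cleared. Necessity
  (\<open>coefficient_bound_if_quotient_bound\<close>) restricts the defining inequality to real
  \<open>z = r \<in> (0, 1)\<close>, where everything is real; it becomes \<open>\<Sum> S n a n r\<^sup>\<mu>\<^sup>n < c r\<close>, and
  \<open>r \<rightarrow> 1\<close> gives the bound. Clearing the fraction there needs \<open>D(r) > 0\<close>, while the class only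
  provides \<open>D(r) \<noteq> 0\<close>; the sign is settled by continuity and the behaviour at \<open>0\<close>
  (\<open>mu_series_positive_on_reals\<close>).

  Convolution and the operators \<open>D\<^sub>\<mu>\<^sup>\<beta>\<close> are defined through the coefficients of a function and
  through infinite sums, so both steps rely on uniqueness of the coefficients and on the
  convergence of all series involved. Both follow from ordinary power series in the variable
  \<open>w = z\<^sup>\<mu>\<close>.
\<close>

section \<open>Series in powers of \<open>z\<^sup>\<mu>\<close>\<close>

lemma powr_mu_multiple:
  fixes z :: complex
  assumes "0 < n"
  shows "z powr of_real (\<mu> * real n) = (z powr of_real \<mu>) ^ n"
proof (cases "z = 0")
  case False
  then show ?thesis by (simp add: powr_power mult.commute)
qed (use assms in auto)

lemma powr_less_one_base:
  fixes x s :: real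
  assumes "0 < x" and "x < 1" and "0 < s"
  shows "x powr s < 1"
  using powr_less_mono2[of s x 1] assms by simp

lemma norm_powr_mu_multiple:
  fixes z :: complex
  shows "norm (z powr of_real (\<mu> * real n)) = norm z powr (\<mu> * real n)"
  by (subst norm_powr_real_powr') auto

text \<open>
  Absolute convergence of the ordinary power series \<open>\<Sum> a n w\<^sup>n\<close> for \<open>|w| < 1\<close>, the variable being
  \<open>w = z\<^sup>\<mu>\<close>. Unlike \<open>has_mu_series\<close>, this speaks of all indices, since the finitely many extra terms
  do not matter and power series facts then apply without a shift.
\<close>

definition disc_summable :: "(nat \<Rightarrow> complex) \<Rightarrow> bool" where
  "disc_summable a \<longleftrightarrow> (\<forall>t::real. 0 \<le> t \<and> t < 1 \<longrightarrow> summable (\<lambda>n. norm (a n) * t ^ n))"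

text \<open>
  At \<open>t = s\<^sup>2\<close> the terms of the Hadamard product factor as \<open>(a n s\<^sup>n) (b n s\<^sup>n)\<close>, a bounded
  sequence times a summable one.
\<close>

lemma disc_summable_mult:
  assumes "disc_summable a" and "disc_summable b"
  shows "disc_summable (\<lambda>n. a n * b n)"
  unfolding disc_summable_def
proof (intro allI impI)
  fix t :: real
  assume t: "0 \<le> t \<and> t < 1"
  define s where "s = sqrt t"
  have s: "0 \<le> s" "s < 1" "s * s = t"
    using t by (auto simp: s_def)
  have sa: "summable (\<lambda>n. norm (a n) * s ^ n)" and sb: "summable (\<lambda>n. norm (b n) * s ^ n)"
    using assms s by (auto simp: disc_summable_def)
  obtain K where K: "\<And>n. norm (norm (a n) * s ^ n) \<le> K"
    using summable_imp_Bseq[OF sa] by (auto simp: Bseq_def)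
  show "summable (\<lambda>n. norm (a n * b n) * t ^ n)"
  proof (rule summable_comparison_test'[OF summable_mult[OF sb, of K]])
    fix n :: nat
    have "norm (norm (a n * b n) * t ^ n) = (norm (a n) * s ^ n) * (norm (b n) * s ^ n)"
      using s by (simp add: norm_mult power_mult_distrib flip: s(3))
    also have "\<dots> \<le> K * (norm (b n) * s ^ n)"
      using K[of n] s by (intro mult_right_mono) auto
    finally show "norm (norm (a n * b n) * t ^ n) \<le> K * (norm (b n) * s ^ n)" .
  qed
qed

text \<open>
  The weights of \<open>D\<^sub>\<mu>\<^sup>\<beta>\<close> form a \<open>\<beta>\<close>-fold Hadamard product of the series \<open>\<Sum> \<mu> n w\<^sup>n\<close>, so they do
  not affect convergence in the disc.
\<close>

lemma disc_summable_weight: "disc_summable (\<lambda>n. of_real ((\<mu> * real n) ^ \<beta>))"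
proof (induction \<beta>)
  case 0
  show ?case by (simp add: disc_summable_def summable_geometric)
next
  case (Suc \<beta>)
  have "disc_summable (\<lambda>n. of_real (\<mu> * real n))"
    unfolding disc_summable_def
  proof (intro allI impI)
    fix t :: real
    assume t: "0 \<le> t \<and> t < 1"
    have "summable (\<lambda>n. real (Suc n) * t ^ n)"
      using geometric_deriv_sums[of t] t by (auto simp: sums_iff)
    then have "summable (\<lambda>n. \<bar>\<mu>\<bar> * (real (Suc n) * t ^ n))"
      by (rule summable_mult)
    then show "summable (\<lambda>n. norm (of_real (\<mu> * real n) :: complex) * t ^ n)"
      by (rule summable_comparison_test'[where N = 0])
        (use t in \<open>auto simp: norm_mult abs_mult mult.assoc intro!: mult_left_mono mult_right_mono\<close>)
  qed
  from disc_summable_mult[OF this Suc] show ?case by simp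
qed

text \<open>
  Every \<open>u \<in> (0, 1)\<close> equals \<open>r\<^sup>\<mu>\<close> for some \<open>r \<in> (0, 1)\<close>, so convergence on the positive radius
  alone already makes the radius of convergence in \<open>w\<close> at least \<open>1\<close>.
\<close>

lemma has_mu_series_imp_disc_summable:
  assumes "1 \<le> \<mu>" and F: "has_mu_series \<mu> F a"
  shows "disc_summable a"
  unfolding disc_summable_def
proof (intro allI impI)
  fix t :: real
  assume t: "0 \<le> t \<and> t < 1"
  define u where "u = (1 + t) / 2"
  have u: "0 < u" "u < 1" "t < u" using t by (auto simp: u_def)
  define r where "r = u powr (1 / \<mu>)"
  have r: "0 \<le> r" "r < 1" "r powr \<mu> = u"
    using u assms(1) by (auto simp: r_def powr_powr powr_less_one_base)
  have eq: "complex_of_real r powr of_real (\<mu> * real (n + 2)) = of_real u ^ (n + 2)" for n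
    using r powr_mu_multiple[of "n + 2" "of_real r" \<mu>] by (simp add: powr_of_real)
  have "summable (\<lambda>n. a (n + 2) * complex_of_real r powr of_real (\<mu> * real (n + 2)))"
    using F r unfolding has_mu_series_def by (auto dest!: spec[of _ "of_real r"] simp: sums_iff)
  then have "summable (\<lambda>n. a (n + 2) * of_real u ^ (n + 2))"
    unfolding eq .
  then have "summable (\<lambda>n. a n * of_real u ^ n)"
    by (subst (asm) summable_iff_shift)
  from powser_insidea[OF this, of "of_real t"] show "summable (\<lambda>n. norm (a n) * t ^ n)"
    using t u by (simp add: norm_mult norm_power)
qed

lemma disc_summable_imp_summable_norm:
  assumes "1 \<le> \<mu>" and "disc_summable a" and "norm z < 1"
  shows "summable (\<lambda>n. norm (a (n + 2) * z powr of_real (\<mu> * real (n + 2))))"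
proof -
  have lt: "norm (z powr of_real \<mu>) < 1"
    using norm_powr_mu_multiple[of z \<mu> 1] assms
    by (cases "z = 0") (auto simp: powr_less_one_base)
  have eq: "z powr of_real (\<mu> * real (n + 2)) = (z powr of_real \<mu>) ^ (n + 2)" for n
    by (rule powr_mu_multiple) simp
  have "summable (\<lambda>n. norm (a n) * norm (z powr of_real \<mu>) ^ n)"
    using assms(2) lt by (simp add: disc_summable_def)
  then have "summable (\<lambda>n. norm (a (n + 2)) * norm (z powr of_real \<mu>) ^ (n + 2))"
    by (subst summable_iff_shift)
  then show ?thesis
    unfolding eq by (simp add: norm_mult norm_power)
qed

lemma has_mu_series_intro:
  assumes "1 \<le> \<mu>" and "disc_summable a"
    and "\<And>z. F z = z + (\<Sum>n. a (n + 2) * z powr of_real (\<mu> * real (n + 2)))"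
  shows "has_mu_series \<mu> F a"
  unfolding has_mu_series_def
  using summable_sums[OF summable_norm_cancel[OF disc_summable_imp_summable_norm[OF assms(1,2)]]]
  by (simp add: assms(3))

lemma has_mu_series_cong:
  assumes "has_mu_series \<mu> F a" and "\<And>n. 2 \<le> n \<Longrightarrow> a n = b n"
  shows "has_mu_series \<mu> F b"
  using assms by (simp add: has_mu_series_def)

text \<open>
  On the positive radius the difference of the two expansions is a power series in \<open>w\<close> that
  vanishes on \<open>(0, 1)\<close>; its zero at \<open>0\<close> is not isolated, so all its coefficients vanish.
\<close>

lemma has_mu_series_unique:
  assumes "1 \<le> \<mu>" and F: "has_mu_series \<mu> F a" and G: "has_mu_series \<mu> F b" and "2 \<le> n"
  shows "a n = b n"
proof (rule ccontr)
  assume neq: "a n \<noteq> b n"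
  define d where "d i = (if i < 2 then 0 else a i - b i)" for i
  define g where "g w = (\<Sum>i. d i * w ^ i)" for w
  have da: "disc_summable a" and db: "disc_summable b"
    using has_mu_series_imp_disc_summable assms by auto
  have sd: "summable (\<lambda>i. d i * w ^ i)" if w: "norm w < 1" for w
  proof (rule summable_norm_cancel, rule summable_comparison_test'[where N = 0])
    show "summable (\<lambda>i. norm (a i) * norm w ^ i + norm (b i) * norm w ^ i)"
      using da db w by (intro summable_add) (auto simp: disc_summable_def)
    show "norm (norm (d i * w ^ i)) \<le> norm (a i) * norm w ^ i + norm (b i) * norm w ^ i" for i
      using norm_triangle_ineq4[of "a i" "b i"]
      by (auto simp: d_def norm_mult norm_power simp flip: distrib_right intro!: mult_right_mono)
  qed
  have zero: "g (of_real x) = 0" if x: "0 < x" "x < 1" for x :: real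
  proof -
    define r where "r = x powr (1 / \<mu>)"
    have r: "0 \<le> r" "r < 1" "r powr \<mu> = x"
      using x assms(1) by (auto simp: r_def powr_powr powr_less_one_base)
    have eq: "complex_of_real r powr of_real (\<mu> * real (i + 2)) = of_real x ^ (i + 2)" for i
      using r powr_mu_multiple[of "i + 2" "of_real r" \<mu>] by (simp add: powr_of_real)
    have nr: "norm (complex_of_real r) < 1" using r by simp
    have "(\<lambda>i. a (i + 2) * of_real x ^ (i + 2) - b (i + 2) * of_real x ^ (i + 2)) sums
        ((F (of_real r) - of_real r) - (F (of_real r) - of_real r))"
      using F G nr unfolding has_mu_series_def eq[symmetric] by (intro sums_diff) blast+
    then have "(\<lambda>i. d (i + 2) * of_real x ^ (i + 2)) sums 0"
      by (simp add: d_def algebra_simps)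
    then have "(\<lambda>i. d i * of_real x ^ i) sums (0 + (\<Sum>i<2. d i * of_real x ^ i))"
      by (subst (asm) sums_iff_shift)
    then show ?thesis
      by (simp add: g_def sums_iff d_def)
  qed
  have g0: "g 0 = 0" by (simp add: g_def d_def)
  have sg: "\<And>w. norm (w - 0) < 1 \<Longrightarrow> (\<lambda>i. d i * (w - 0) ^ i) sums g w"
    using sd by (simp add: g_def summable_sums)
  have "d n \<noteq> 0" "0 < n" using neq \<open>2 \<le> n\<close> by (auto simp: d_def)
  then obtain s where s: "0 < s" "\<And>z. z \<in> cball 0 s - {0} \<Longrightarrow> g z \<noteq> 0"
    using powser_0_nonzero[OF zero_less_one sg g0] by blast
  have "g (of_real (min s (1/2))) \<noteq> 0"
    using s(1) by (intro s(2)) auto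
  then show False using zero[of "min s (1/2)"] s(1) by auto
qed

lemma mu_coeff_eq:
  assumes "1 \<le> \<mu>" and "has_mu_series \<mu> F a" and "2 \<le> n"
  shows "mu_coeff \<mu> F n = a n"
proof -
  have "has_mu_series \<mu> F (mu_coeff \<mu> F)"
    unfolding mu_coeff_def by (rule someI[where P = "has_mu_series \<mu> F", OF assms(2)])
  then show ?thesis using has_mu_series_unique assms by blast
qed

lemma has_mu_series_conv:
  assumes "1 \<le> \<mu>" and "has_mu_series \<mu> F a" and "has_mu_series \<mu> G b"
  shows "has_mu_series \<mu> (mu_conv \<mu> F G) (\<lambda>n. a n * b n)"
proof (rule has_mu_series_intro[OF assms(1)])
  show "disc_summable (\<lambda>n. a n * b n)"
    using assms by (blast intro: disc_summable_mult has_mu_series_imp_disc_summable)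
qed (use assms in \<open>simp add: mu_conv_def mu_coeff_eq\<close>)

lemma has_mu_series_D:
  assumes "1 \<le> \<mu>" and "has_mu_series \<mu> F a"
  shows "has_mu_series \<mu> (mu_D \<mu> \<beta> F) (\<lambda>n. of_real ((\<mu> * real n) ^ \<beta>) * a n)"
proof (rule has_mu_series_intro[OF assms(1)])
  show "disc_summable (\<lambda>n. of_real ((\<mu> * real n) ^ \<beta>) * a n)"
    by (rule disc_summable_mult[OF disc_summable_weight has_mu_series_imp_disc_summable])
      (use assms in auto)
qed (use assms in \<open>simp add: mu_D_def mu_coeff_eq\<close>)

section \<open>The coefficient condition is sufficient\<close>

text \<open>
  All exponents satisfy \<open>\<mu> n \<ge> 2\<close>, hence \<open>x\<^sup>\<mu>\<^sup>n \<le> x\<^sup>2 < x\<close>. This is what turns the weak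
  inequality for the coefficients into a strict one inside the disc.
\<close>

lemma mu_tail_less:
  fixes t :: "nat \<Rightarrow> real"
  assumes "1 \<le> \<mu>" and t: "\<And>n. 2 \<le> n \<Longrightarrow> 0 \<le> t n"
    and sm: "summable (\<lambda>n. t (n + 2))" and le: "(\<Sum>n. t (n + 2)) \<le> K" and "0 < K"
    and x: "0 < x" "x < 1"
  shows "summable (\<lambda>n. t (n + 2) * x powr (\<mu> * real (n + 2)))"
    and "(\<Sum>n. t (n + 2) * x powr (\<mu> * real (n + 2))) < K * x"
proof -
  have e: "x powr (\<mu> * real (n + 2)) \<le> x ^ 2" for n
  proof -
    have "1 * 2 \<le> \<mu> * real (n + 2)"
      using assms(1) by (intro mult_mono) auto
    then have "x powr (\<mu> * real (n + 2)) \<le> x powr 2"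
      using x by (intro powr_mono') auto
    then show ?thesis using x by simp
  qed
  have b: "t (n + 2) * x powr (\<mu> * real (n + 2)) \<le> t (n + 2) * x ^ 2" for n
    using t by (intro mult_left_mono e) auto
  have sx: "summable (\<lambda>n. t (n + 2) * x ^ 2)"
    by (rule summable_mult2[OF sm])
  show s: "summable (\<lambda>n. t (n + 2) * x powr (\<mu> * real (n + 2)))"
    by (rule summable_comparison_test'[OF sx, where N = 0]) (use b t in auto)
  have "(\<Sum>n. t (n + 2) * x powr (\<mu> * real (n + 2))) \<le> (\<Sum>n. t (n + 2) * x ^ 2)"
    by (rule suminf_le[OF b s sx])
  also have "\<dots> = (\<Sum>n. t (n + 2)) * x ^ 2"
    by (rule suminf_mult2[OF sm, symmetric])
  also have "\<dots> \<le> K * x ^ 2"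
    using le by (intro mult_right_mono) auto
  also have "\<dots> < K * x"
    using x \<open>0 < K\<close> by (simp add: power2_eq_square)
  finally show "(\<Sum>n. t (n + 2) * x powr (\<mu> * real (n + 2))) < K * x" .
qed

lemma norm_mu_series_tail_le:
  fixes z w :: complex
  assumes "norm z < 1"
    and sums: "(\<lambda>n. a (n + 2) * z powr of_real (\<mu> * real (n + 2))) sums w"
    and a: "\<And>n. 2 \<le> n \<Longrightarrow> norm (a n) \<le> t n"
    and sm: "summable (\<lambda>n. t (n + 2) * norm z powr (\<mu> * real (n + 2)))"
  shows "norm w \<le> (\<Sum>n. t (n + 2) * norm z powr (\<mu> * real (n + 2)))"
proof -
  have "norm (\<Sum>n. a (n + 2) * z powr of_real (\<mu> * real (n + 2)))
      \<le> (\<Sum>n. t (n + 2) * norm z powr (\<mu> * real (n + 2)))"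
    by (rule norm_suminf_le[OF _ sm])
      (unfold norm_mult norm_powr_mu_multiple, intro mult_right_mono a, auto)
  then show ?thesis using sums by (simp add: sums_iff)
qed

lemma mu_series_nonzero:
  fixes t :: "nat \<Rightarrow> real"
  assumes "1 \<le> \<mu>" and G: "has_mu_series \<mu> G (\<lambda>n. - of_real (t n))"
    and t: "\<And>n. 2 \<le> n \<Longrightarrow> 0 \<le> t n"
    and sm: "summable (\<lambda>n. t (n + 2))" and le: "(\<Sum>n. t (n + 2)) \<le> 1"
    and z: "0 < norm z" "norm z < 1"
  shows "G z \<noteq> 0"
proof
  assume "G z = 0"
  then have "(\<lambda>n. - of_real (t (n + 2)) * z powr of_real (\<mu> * real (n + 2))) sums (- z)"
    using G z by (auto simp: has_mu_series_def)
  from norm_mu_series_tail_le[OF z(2) this, of t] mu_tail_less[OF assms(1) t sm le _ z] t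
  show False by auto
qed

text \<open>
  With \<open>X = \<Sum> (p n - s n) |z|\<^sup>\<mu>\<^sup>n\<close> and \<open>Y = \<Sum> s n |z|\<^sup>\<mu>\<^sup>n\<close>, the hypothesis gives
  \<open>(1 - B) X + c Y < c |z|\<close>. Since \<open>|N - D| \<le> X\<close> and \<open>|D - z| \<le> Y\<close>, the cleared denominator
  satisfies \<open>|c D - B (N - D)| \<ge> c |z| - c Y + B |N - D| > |N - D|\<close>.
\<close>

lemma quotient_bound_if_coefficient_bound:
  fixes p s :: "nat \<Rightarrow> real"
  assumes "1 \<le> \<mu>" and N: "has_mu_series \<mu> N (\<lambda>n. - of_real (p n))"
    and D: "has_mu_series \<mu> D (\<lambda>n. - of_real (s n))"
    and s: "\<And>n. 2 \<le> n \<Longrightarrow> 0 \<le> s n" and p: "\<And>n. 2 \<le> n \<Longrightarrow> s n \<le> p n"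
    and c: "0 < c" and B: "B < 0"
    and sm: "summable (\<lambda>n. (1 - B) * (p (n + 2) - s (n + 2)) + c * s (n + 2))"
    and le: "(\<Sum>n. (1 - B) * (p (n + 2) - s (n + 2)) + c * s (n + 2)) \<le> c"
    and z: "0 < norm z" "norm z < 1" and Dz: "D z \<noteq> 0"
  defines "d \<equiv> of_real c - of_real B * (N z / D z - 1)"
  shows "d \<noteq> 0" and "norm ((N z / D z - 1) / d) < 1"
proof -
  let ?e = "\<lambda>n. norm z powr (\<mu> * real (n + 2))"
  define S where "S n = (1 - B) * (p n - s n) + c * s n" for n
  have S: "0 \<le> S n" if "2 \<le> n" for n
    using s p c B that by (auto simp: S_def)
  have smS: "summable (\<lambda>n. S (n + 2))" and leS: "(\<Sum>n. S (n + 2)) \<le> c"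
    using sm le by (auto simp: S_def)
  have tail: "summable (\<lambda>n. S (n + 2) * ?e n)" "(\<Sum>n. S (n + 2) * ?e n) < c * norm z"
    using mu_tail_less[OF assms(1) S smS leS c z] by auto
  define X where "X = (\<Sum>n. (p (n + 2) - s (n + 2)) * ?e n)"
  define Y where "Y = (\<Sum>n. s (n + 2) * ?e n)"
  have sX: "summable (\<lambda>n. (p (n + 2) - s (n + 2)) * ?e n)"
  proof (rule summable_comparison_test'[OF tail(1), where N = 0])
    fix n :: nat
    have "1 * (p (n + 2) - s (n + 2)) \<le> (1 - B) * (p (n + 2) - s (n + 2))"
      using p B by (intro mult_right_mono) auto
    also have "\<dots> \<le> S (n + 2)" using s c by (simp add: S_def)
    finally show "norm ((p (n + 2) - s (n + 2)) * ?e n) \<le> S (n + 2) * ?e n"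
      using p[of "n + 2"] by (auto simp: abs_mult intro!: mult_right_mono)
  qed
  have sY: "summable (\<lambda>n. s (n + 2) * ?e n)"
  proof (rule summable_comparison_test'[OF summable_divide[OF tail(1), of c], where N = 0])
    fix n :: nat
    have "c * s (n + 2) \<le> S (n + 2)"
      using p B by (simp add: S_def)
    then have "c * s (n + 2) * ?e n \<le> S (n + 2) * ?e n"
      by (intro mult_right_mono) auto
    then show "norm (s (n + 2) * ?e n) \<le> S (n + 2) * ?e n / c"
      using s[of "n + 2"] c by (simp add: abs_mult field_simps)
  qed
  have "(1 - B) * X + c * Y = (\<Sum>n. (1 - B) * ((p (n + 2) - s (n + 2)) * ?e n) + c * (s (n + 2) * ?e n))"
    unfolding X_def Y_def
    by (simp only: suminf_add[symmetric] suminf_mult[symmetric] sX sY summable_mult)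
  also have "\<dots> = (\<Sum>n. S (n + 2) * ?e n)"
    by (simp add: S_def algebra_simps)
  finally have XY: "(1 - B) * X + c * Y < c * norm z" using tail(2) by simp
  have "(\<lambda>n. - of_real (p (n + 2)) * z powr of_real (\<mu> * real (n + 2))
      - - of_real (s (n + 2)) * z powr of_real (\<mu> * real (n + 2))) sums ((N z - z) - (D z - z))"
    using N D z by (intro sums_diff) (auto simp: has_mu_series_def)
  then have "(\<lambda>n. of_real (s (n + 2) - p (n + 2)) * z powr of_real (\<mu> * real (n + 2)))
      sums (N z - D z)"
    by (simp add: algebra_simps)
  from norm_mu_series_tail_le[where a = "\<lambda>n. of_real (s n - p n)", OF z(2) this _ sX]
  have nX: "norm (N z - D z) \<le> X"
    using p by (simp add: X_def norm_of_real del: of_real_diff)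
  have "(\<lambda>n. - of_real (s (n + 2)) * z powr of_real (\<mu> * real (n + 2))) sums (D z - z)"
    using D z by (auto simp: has_mu_series_def)
  from norm_mu_series_tail_le[where a = "\<lambda>n. - of_real (s n)", OF z(2) this _ sY]
  have nY: "norm (D z - z) \<le> Y"
    using s by (simp add: Y_def)
  \<comment> \<open>the denominator \<open>d\<close> multiplied by \<open>D z\<close>\<close>
  define u where "u = of_real c * D z - of_real B * (N z - D z)"
  have "of_real c * z = u + of_real B * (N z - D z) - of_real c * (D z - z)"
    by (simp add: u_def algebra_simps)
  then have "c * norm z = norm (u + of_real B * (N z - D z) - of_real c * (D z - z))"
    using c by (metis norm_mult norm_of_real abs_of_pos)
  also have "\<dots> \<le> norm u + norm (of_real B * (N z - D z)) + norm (of_real c * (D z - z))"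
    by (meson add_right_mono norm_triangle_ineq norm_triangle_ineq4 order_trans)
  also have "\<dots> = norm u - B * norm (N z - D z) + c * norm (D z - z)"
    using B c by (simp add: norm_mult)
  also have "\<dots> \<le> norm u - B * X + c * Y"
    using nX nY B c by (intro add_mono diff_mono mult_left_mono mult_left_mono_neg) auto
  finally have u: "norm (N z - D z) < norm u"
    using XY nX by (simp add: algebra_simps)
  have dq: "d = u / D z" and qq: "N z / D z - 1 = (N z - D z) / D z"
    using Dz by (auto simp: d_def u_def field_simps)
  have u0: "u \<noteq> 0" using u by auto
  then show "d \<noteq> 0" using Dz dq by simp
  have "(N z / D z - 1) / d = (N z - D z) / u"
    unfolding dq qq using Dz u0 by (simp add: field_simps)
  then show "norm ((N z / D z - 1) / d) < 1"
    using u u0 by (simp add: norm_divide)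
qed

section \<open>The coefficient condition is necessary\<close>

lemma mu_series_real:
  fixes s :: "nat \<Rightarrow> real"
  assumes "1 \<le> \<mu>" and D: "has_mu_series \<mu> D (\<lambda>n. - of_real (s n))" and r: "0 < r" "r < 1"
  shows "summable (\<lambda>n. s (n + 2) * r powr (\<mu> * real (n + 2)))"
    and "D (of_real r) = of_real (r - (\<Sum>n. s (n + 2) * r powr (\<mu> * real (n + 2))))"
proof -
  have "(\<lambda>n. - of_real (s (n + 2)) * complex_of_real r powr of_real (\<mu> * real (n + 2)))
      sums (D (of_real r) - of_real r)"
    using D r by (auto simp: has_mu_series_def)
  also have "(\<lambda>n. - of_real (s (n + 2)) * complex_of_real r powr of_real (\<mu> * real (n + 2)))
      = (\<lambda>n. complex_of_real (- (s (n + 2) * r powr (\<mu> * real (n + 2)))))"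
    using r by (subst powr_of_real) auto
  finally have *: "(\<lambda>n. complex_of_real (- (s (n + 2) * r powr (\<mu> * real (n + 2)))))
      sums (D (of_real r) - of_real r)" .
  have "summable (\<lambda>n. - (s (n + 2) * r powr (\<mu> * real (n + 2))))"
    using sums_Re[OF *] by (auto simp: sums_iff)
  then show sm: "summable (\<lambda>n. s (n + 2) * r powr (\<mu> * real (n + 2)))"
    by (subst (asm) summable_minus_iff)
  have "(\<lambda>n. complex_of_real (- (s (n + 2) * r powr (\<mu> * real (n + 2)))))
      sums of_real (- (\<Sum>n. s (n + 2) * r powr (\<mu> * real (n + 2))))"
    by (intro sums_of_real sums_minus summable_sums sm)
  with * have "D (of_real r) - of_real r
      = of_real (- (\<Sum>n. s (n + 2) * r powr (\<mu> * real (n + 2))))"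
    by (rule sums_unique2)
  then show "D (of_real r) = of_real (r - (\<Sum>n. s (n + 2) * r powr (\<mu> * real (n + 2))))"
    by (simp add: algebra_simps)
qed

text \<open>
  By the intermediate value theorem a nonvanishing \<open>D\<close> has constant sign on \<open>(0, 1)\<close>, and near
  \<open>0\<close> it is positive because the tail is \<open>O(r\<^sup>2)\<close>. Continuity is read off after factoring the
  tail as \<open>w\<^sup>2 g(w)\<close> with \<open>w = r\<^sup>\<mu>\<close> and \<open>g\<close> a power series.
\<close>

lemma mu_series_positive_on_reals:
  fixes s :: "nat \<Rightarrow> real"
  assumes "1 \<le> \<mu>" and D: "has_mu_series \<mu> D (\<lambda>n. - of_real (s n))"
    and s: "\<And>n. 2 \<le> n \<Longrightarrow> 0 \<le> s n"
    and nz: "\<And>r. 0 < r \<Longrightarrow> r < 1 \<Longrightarrow> D (of_real r) \<noteq> 0"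
    and r: "0 < r" "r < 1"
  shows "0 < r - (\<Sum>n. s (n + 2) * r powr (\<mu> * real (n + 2)))"
proof -
  define g where "g x = (\<Sum>n. s (n + 2) * x ^ n)" for x :: real
  define h where "h x = x - (x powr \<mu>)\<^sup>2 * g (x powr \<mu>)" for x :: real
  have sg: "summable (\<lambda>n. s (n + 2) * x ^ n)" if x: "0 < x" "x < 1" for x :: real
  proof -
    have "summable (\<lambda>n. \<bar>s n\<bar> * x ^ n)"
      using has_mu_series_imp_disc_summable[OF assms(1) D] x by (simp add: disc_summable_def)
    then have "summable (\<lambda>n. \<bar>s (n + 2)\<bar> * x ^ (n + 2))"
      by (subst summable_iff_shift)
    moreover have "\<bar>s (n + 2)\<bar> * x ^ (n + 2) = x ^ 2 * (s (n + 2) * x ^ n)" for n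
      using s[of "n + 2"] by (simp add: power_add power2_eq_square)
    ultimately have "summable (\<lambda>n. x ^ 2 * (s (n + 2) * x ^ n))"
      by (simp only:)
    then show ?thesis using x by (subst (asm) summable_cmult_iff) auto
  qed
  have heq: "h x = x - (\<Sum>n. s (n + 2) * x powr (\<mu> * real (n + 2)))" if x: "0 < x" "x < 1" for x
  proof -
    have xm: "0 < x powr \<mu>" "x powr \<mu> < 1"
      using x assms(1) by (auto simp: powr_less_one_base)
    have "x powr (\<mu> * real (n + 2)) = (x powr \<mu>)\<^sup>2 * (x powr \<mu>) ^ n" for n
    proof -
      have "x powr (\<mu> * real (n + 2)) = (x powr \<mu>) ^ (n + 2)"
        by (subst powr_power) (use x in \<open>auto simp: mult.commute\<close>)
      then show ?thesis by (simp add: power_add power2_eq_square)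
    qed
    then have "(\<Sum>n. s (n + 2) * x powr (\<mu> * real (n + 2)))
        = (\<Sum>n. (x powr \<mu>)\<^sup>2 * (s (n + 2) * (x powr \<mu>) ^ n))"
      by (simp add: mult_ac)
    also have "\<dots> = (x powr \<mu>)\<^sup>2 * g (x powr \<mu>)"
      unfolding g_def by (rule suminf_mult[OF sg[OF xm]])
    finally show ?thesis by (simp add: h_def)
  qed
  have hnz: "h x \<noteq> 0" if "0 < x" "x < 1" for x
    using nz[OF that] mu_series_real(2)[OF assms(1) D that] heq[OF that] by auto
  have gcont: "isCont g x" if x: "0 < x" "x < 1" for x
    unfolding g_def[abs_def]
    by (rule isCont_powser[OF sg[of "(1 + x) / 2"]]) (use x in auto)
  have hcont: "isCont h x" if x: "0 < x" "x < 1" for x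
  proof -
    have xm: "0 < x powr \<mu>" "x powr \<mu> < 1"
      using x assms(1) by (auto simp: powr_less_one_base)
    have "isCont (\<lambda>x. x powr \<mu>) x" using x by (intro continuous_intros) auto
    then show ?thesis
      unfolding h_def[abs_def] using x
      by (intro continuous_intros isCont_o2[where f = "\<lambda>x. x powr \<mu>" and g = g, OF _ gcont[OF xm]]) auto
  qed
  define K where "K = g (1 / 2)"
  have K0: "0 \<le> K" unfolding K_def g_def using s by (intro suminf_nonneg sg) auto
  \<comment> \<open>a point where \<open>D\<close> is certainly positive: as \<open>x\<^sup>\<mu> \<le> x \<le> 1/2\<close>, the tail is at most \<open>K x\<^sup>2 < x\<close>\<close>
  define x where "x = min r (1 / (2 * (K + 1)))"
  have x: "0 < x" "x \<le> r" "x \<le> 1 / (2 * (K + 1))" using r K0 by (auto simp: x_def)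
  have "1 / (2 * (K + 1)) \<le> 1 / 2" using K0 by (simp add: field_simps)
  then have x2: "x \<le> 1 / 2" using x by linarith
  have xm: "0 < x powr \<mu>" "x powr \<mu> \<le> x"
  proof -
    have "x powr \<mu> \<le> x powr 1" using x x2 assms(1) by (intro powr_mono') auto
    then show "x powr \<mu> \<le> x" using x by simp
  qed (use x in auto)
  have gK: "g (x powr \<mu>) \<le> K"
    unfolding g_def K_def
    using xm x2 s by (intro suminf_le sg mult_left_mono power_mono) auto
  have g0: "0 \<le> g (x powr \<mu>)"
    unfolding g_def using xm x2 s by (intro suminf_nonneg sg mult_nonneg_nonneg) auto
  have "(x powr \<mu>)\<^sup>2 * g (x powr \<mu>) \<le> x\<^sup>2 * K"
    using xm gK g0 by (intro mult_mono power_mono) auto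
  also have "\<dots> = x * (x * K)" by (simp add: power2_eq_square)
  also have "\<dots> < x * 1"
  proof (rule mult_strict_left_mono)
    have "x * K \<le> 1 / (2 * (K + 1)) * K" using x K0 by (intro mult_right_mono)
    also have "\<dots> < 1" using K0 by (simp add: field_simps)
    finally show "x * K < 1" .
  qed (use x in auto)
  finally have hx: "0 < h x" by (simp add: h_def)
  have "0 < h r"
  proof (rule ccontr)
    assume "\<not> 0 < h r"
    then have "\<exists>y. x \<le> y \<and> y \<le> r \<and> h y = 0"
      using hx x r by (intro IVT2) (auto intro!: hcont)
    then show False using hnz x r by force
  qed
  then show ?thesis using heq[OF r] by simp
qed

text \<open>
  At a real point \<open>r\<close>, put \<open>t = 1 - q(r) \<ge> 0\<close>; the hypothesis reads \<open>t < |c + B t|\<close>. The case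
  \<open>c + B t < 0\<close> is excluded, for then \<open>|c + B t| = - c - B t \<le> t - c < t\<close> as \<open>-1 \<le> B\<close>. Hence
  \<open>(1 - B) t < c\<close>, and multiplying by \<open>D(r) > 0\<close> gives the coefficient inequality weighted by
  \<open>r\<^sup>\<mu>\<^sup>n\<close>. Partial sums have nonnegative terms and pass to the limit \<open>r \<rightarrow> 1\<close>.
\<close>

lemma coefficient_bound_if_quotient_bound:
  fixes p s :: "nat \<Rightarrow> real"
  assumes "1 \<le> \<mu>" and N: "has_mu_series \<mu> N (\<lambda>n. - of_real (p n))"
    and D: "has_mu_series \<mu> D (\<lambda>n. - of_real (s n))"
    and s: "\<And>n. 2 \<le> n \<Longrightarrow> 0 \<le> s n" and p: "\<And>n. 2 \<le> n \<Longrightarrow> s n \<le> p n"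
    and c: "0 < c" and B: "-1 \<le> B" "B < 0"
    and nz: "\<And>z. 0 < norm z \<Longrightarrow> norm z < 1 \<Longrightarrow> D z \<noteq> 0"
    and dnz: "\<And>z. 0 < norm z \<Longrightarrow> norm z < 1 \<Longrightarrow>
      of_real c - of_real B * (N z / D z - 1) \<noteq> 0"
    and quot: "\<And>z. 0 < norm z \<Longrightarrow> norm z < 1 \<Longrightarrow>
      norm ((N z / D z - 1) / (of_real c - of_real B * (N z / D z - 1))) < 1"
  shows "summable (\<lambda>n. (1 - B) * (p (n + 2) - s (n + 2)) + c * s (n + 2))"
    and "(\<Sum>n. (1 - B) * (p (n + 2) - s (n + 2)) + c * s (n + 2)) \<le> c"
proof -
  define S where "S n = (1 - B) * (p n - s n) + c * s n" for n
  have S: "0 \<le> S n" if "2 \<le> n" for n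
    using s p c B that by (auto simp: S_def)
  have partial: "(\<Sum>n<j. S (n + 2) * r powr (\<mu> * real (n + 2))) \<le> c * r"
    if r: "0 < r" "r < 1" for r j
  proof -
    let ?e = "\<lambda>n. r powr (\<mu> * real (n + 2))"
    define P where "P = (\<Sum>n. p (n + 2) * ?e n)"
    define Q where "Q = (\<Sum>n. s (n + 2) * ?e n)"
    note Nr = mu_series_real[OF assms(1) N r] and Dr = mu_series_real[OF assms(1) D r]
    have Q: "0 < r - Q"
      unfolding Q_def
      by (rule mu_series_positive_on_reals[OF assms(1) D s _ r]) (use nz in auto)
    have PQ: "Q \<le> P"
      unfolding P_def Q_def using p by (intro suminf_le Nr(1) Dr(1) mult_right_mono) auto
    define t where "t = (P - Q) / (r - Q)"
    have t0: "0 \<le> t" using PQ Q by (simp add: t_def)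
    have "(r - P) / (r - Q) - 1 = - t" using Q by (simp add: t_def field_simps)
    then have q: "N (of_real r) / D (of_real r) - 1 = of_real (- t)"
      unfolding Nr(2) Dr(2) P_def[symmetric] Q_def[symmetric]
      by (metis of_real_1 of_real_diff of_real_divide)
    have d: "of_real c - of_real B * (N (of_real r) / D (of_real r) - 1) = complex_of_real (c + B * t)"
      by (simp add: q)
    have "c + B * t \<noteq> 0"
      using dnz[of "of_real r"] r unfolding d by (simp del: of_real_add)
    moreover have "\<bar>- t / (c + B * t)\<bar> < 1"
      using quot[of "of_real r"] r unfolding d unfolding q
      by (simp only: of_real_divide[symmetric] norm_of_real)
    ultimately have lt: "t < \<bar>c + B * t\<bar>" using t0 by (simp add: abs_divide)
    have "- t \<le> B * t" using t0 B mult_right_mono[of "-1" B t] by simp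
    with lt c have "(1 - B) * t < c" by (auto simp: algebra_simps abs_if split: if_splits)
    then have "(1 - B) * (P - Q) < c * (r - Q)"
      using Q by (simp add: t_def field_simps)
    then have "(1 - B) * (P - Q) + c * Q \<le> c * r" by (simp add: algebra_simps)
    moreover have "(\<lambda>n. (1 - B) * (p (n + 2) * ?e n - s (n + 2) * ?e n) + c * (s (n + 2) * ?e n))
        sums ((1 - B) * (P - Q) + c * Q)"
      unfolding P_def Q_def
      by (intro sums_add sums_mult sums_diff summable_sums Nr(1) Dr(1))
    then have "(\<lambda>n. S (n + 2) * ?e n) sums ((1 - B) * (P - Q) + c * Q)"
      by (simp add: S_def algebra_simps)
    then have "(\<Sum>n<j. S (n + 2) * ?e n) \<le> (1 - B) * (P - Q) + c * Q"
      using S by (intro sum_le_suminf[of _ "{..<j}", THEN order_trans]) (auto simp: sums_iff)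
    ultimately show ?thesis by linarith
  qed
  have le: "(\<Sum>n<j. S (n + 2)) \<le> c" for j
  proof (rule tendsto_le)
    have "((\<lambda>r::real. c * r) \<longlongrightarrow> c * 1) (at_left 1)"
      by (intro tendsto_intros)
    then show "((\<lambda>r::real. c * r) \<longlongrightarrow> c) (at_left 1)"
      by simp
    have "((\<lambda>r::real. \<Sum>n<j. S (n + 2) * r powr (\<mu> * real (n + 2))) \<longlongrightarrow>
        (\<Sum>n<j. S (n + 2) * 1 powr (\<mu> * real (n + 2)))) (at_left 1)"
      by (intro tendsto_intros) auto
    then show "((\<lambda>r::real. \<Sum>n<j. S (n + 2) * r powr (\<mu> * real (n + 2))) \<longlongrightarrow>
        (\<Sum>n<j. S (n + 2))) (at_left 1)"
      by simp
    show "eventually (\<lambda>r. (\<Sum>n<j. S (n + 2) * r powr (\<mu> * real (n + 2))) \<le> c * r) (at_left 1)"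
      using eventually_at_left_real[OF zero_less_one] by (rule eventually_mono) (intro partial, auto)
  qed auto
  have "summable (\<lambda>n. S (n + 2))"
    using S le by (intro summableI_nonneg_bounded[of _ c]) auto
  moreover from this have "(\<Sum>n. S (n + 2)) \<le> c"
    using le by (intro suminf_le_const)
  ultimately show "summable (\<lambda>n. (1 - B) * (p (n + 2) - s (n + 2)) + c * s (n + 2))"
    and "(\<Sum>n. (1 - B) * (p (n + 2) - s (n + 2)) + c * s (n + 2)) \<le> c"
    by (auto simp: S_def)
qed

section \<open>The coefficient criterion and the extreme points\<close>

text \<open>
  The two preceding sections applied to \<open>p n = (\<mu> n)\<^sup>k \<theta> n a n\<close> and \<open>s n = (\<mu> n)\<^sup>m l n a n\<close>.
  The class also asks that \<open>F * \<Psi>\<close> and \<open>D\<^sub>\<mu>\<^sup>m (F * \<Psi>)\<close> have no zeros off the origin. Both have tail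
  coefficients at most \<open>s n \<le> S n a n / c\<close>, whose sum is at most \<open>1\<close>, so the term \<open>z\<close> dominates.
\<close>

lemma class_E_tilde_iff_coefficient_bound:
  fixes \<mu> \<gamma> A B :: real and \<theta> l :: "nat \<Rightarrow> real"
  assumes \<mu>: "1 \<le> \<mu>" and "\<gamma> < 1" and B: "-1 \<le> B" "B < 0" and "B < A"
    and "m \<le> k"
    and \<Phi>: "has_mu_series \<mu> \<Phi> (\<lambda>n. of_real (\<theta> n))"
    and \<Psi>: "has_mu_series \<mu> \<Psi> (\<lambda>n. of_real (l n))"
    and l0: "\<And>n. 2 \<le> n \<Longrightarrow> 0 \<le> l n"
    and l\<theta>: "\<And>n. 2 \<le> n \<Longrightarrow> l n \<le> \<theta> n"
  defines "c \<equiv> (A - B) * (1 - \<gamma>)"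
    and "S \<equiv> (\<lambda>n. (1 - B) * ((\<mu> * real n) ^ k * \<theta> n - (\<mu> * real n) ^ m * l n)
        + (A - B) * (1 - \<gamma>) * (\<mu> * real n) ^ m * l n)"
  shows "F \<in> class_E_tilde k m \<Phi> \<Psi> A B \<mu> \<gamma> \<longleftrightarrow>
    (\<exists>a. (\<forall>n\<ge>2. 0 \<le> a n) \<and> has_mu_series \<mu> F (\<lambda>n. - of_real (a n)) \<and>
      summable (\<lambda>n. S (n + 2) * a (n + 2)) \<and> (\<Sum>n. S (n + 2) * a (n + 2)) \<le> c)"
proof -
  have c: "0 < c" using assms by (simp add: c_def)
  have ge1: "1 \<le> \<mu> * real n" if "2 \<le> n" for n
    using mult_mono[of 1 \<mu> 1 "real n"] \<mu> that by simp
  have core: "F \<in> class_E k m \<Phi> \<Psi> A B \<mu> \<gamma> \<longleftrightarrow>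
      summable (\<lambda>n. S (n + 2) * a (n + 2)) \<and> (\<Sum>n. S (n + 2) * a (n + 2)) \<le> c"
    if a: "\<forall>n\<ge>2. 0 \<le> a n" and F: "has_mu_series \<mu> F (\<lambda>n. - of_real (a n))" for a
  proof -
    define p where "p n = (\<mu> * real n) ^ k * \<theta> n * a n" for n
    define s where "s n = (\<mu> * real n) ^ m * l n * a n" for n
    define N where "N = mu_D \<mu> k (mu_conv \<mu> F \<Phi>)"
    define D where "D = mu_D \<mu> m (mu_conv \<mu> F \<Psi>)"
    have conv: "has_mu_series \<mu> (mu_conv \<mu> F \<Psi>) (\<lambda>n. - of_real (l n * a n))"
      by (rule has_mu_series_cong[OF has_mu_series_conv[OF \<mu> F \<Psi>]]) simp
    have N: "has_mu_series \<mu> N (\<lambda>n. - of_real (p n))"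
      unfolding N_def
      by (rule has_mu_series_cong[OF has_mu_series_D[OF \<mu> has_mu_series_conv[OF \<mu> F \<Phi>]]])
        (simp add: p_def)
    have D: "has_mu_series \<mu> D (\<lambda>n. - of_real (s n))"
      unfolding D_def by (rule has_mu_series_cong[OF has_mu_series_D[OF \<mu> conv]]) (simp add: s_def)
    have la: "0 \<le> l n * a n" if "2 \<le> n" for n
      using l0 a that by simp
    have las: "l n * a n \<le> s n" if "2 \<le> n" for n
      using mult_right_mono[OF one_le_power[OF ge1[OF that]] la[OF that], of m]
      by (simp add: s_def mult.assoc)
    have s0: "0 \<le> s n" if "2 \<le> n" for n
      using la las that by (meson order_trans)
    have sp: "s n \<le> p n" if "2 \<le> n" for n
      unfolding s_def p_def using that a l0 l\<theta> ge1 \<open>m \<le> k\<close>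
      by (intro mult_right_mono mult_mono power_increasing zero_le_power order_trans[OF zero_le_one ge1]) auto
    have Sa: "S n * a n = (1 - B) * (p n - s n) + c * s n" for n
      by (simp add: S_def p_def s_def c_def algebra_simps)
    have E: "F \<in> class_E k m \<Phi> \<Psi> A B \<mu> \<gamma> \<longleftrightarrow>
        (\<forall>z. 0 < norm z \<and> norm z < 1 \<longrightarrow> mu_conv \<mu> F \<Psi> z \<noteq> 0 \<and> D z \<noteq> 0 \<and>
          of_real c - of_real B * (N z / D z - 1) \<noteq> 0 \<and>
          norm ((N z / D z - 1) / (of_real c - of_real B * (N z / D z - 1))) < 1)"
      using F by (auto simp: class_E_def class_A_def Let_def N_def D_def c_def)
    show ?thesis
    proof
      assume "F \<in> class_E k m \<Phi> \<Psi> A B \<mu> \<gamma>"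
      then show "summable (\<lambda>n. S (n + 2) * a (n + 2)) \<and> (\<Sum>n. S (n + 2) * a (n + 2)) \<le> c"
        unfolding E Sa
        by (intro conjI coefficient_bound_if_quotient_bound[OF \<mu> N D s0 sp c B]) blast+
    next
      assume bound: "summable (\<lambda>n. S (n + 2) * a (n + 2)) \<and> (\<Sum>n. S (n + 2) * a (n + 2)) \<le> c"
      \<comment> \<open>used for \<open>t = l a\<close> and for \<open>t = s\<close>\<close>
      have nonzero: "G z \<noteq> 0"
        if G: "has_mu_series \<mu> G (\<lambda>n. - of_real (t n))"
          and t: "\<And>n. 2 \<le> n \<Longrightarrow> 0 \<le> t n" "\<And>n. 2 \<le> n \<Longrightarrow> t n \<le> s n"
          and z: "0 < norm z" "norm z < 1" for G t z
      proof -
        have ct: "t (n + 2) \<le> S (n + 2) * a (n + 2) / c" for n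
        proof -
          have "c * t (n + 2) \<le> c * s (n + 2)"
            using t c by (intro mult_left_mono) auto
          also have "\<dots> \<le> S (n + 2) * a (n + 2)"
            unfolding Sa using sp B by simp
          finally show ?thesis using c by (simp add: field_simps)
        qed
        have sc: "summable (\<lambda>n. S (n + 2) * a (n + 2) / c)"
          using bound by (intro summable_divide) simp
        have st: "summable (\<lambda>n. t (n + 2))"
          by (rule summable_comparison_test'[OF sc, where N = 0]) (use ct t in auto)
        have "(\<Sum>n. t (n + 2)) \<le> (\<Sum>n. S (n + 2) * a (n + 2) / c)"
          by (rule suminf_le[OF ct st sc])
        also have "\<dots> = (\<Sum>n. S (n + 2) * a (n + 2)) / c"
          using bound by (intro suminf_divide) simp
        also have "\<dots> \<le> 1" using bound c by simp
        finally show ?thesis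
          using mu_series_nonzero[OF \<mu> G t(1) st _ z] by blast
      qed
      show "F \<in> class_E k m \<Phi> \<Psi> A B \<mu> \<gamma>"
        unfolding E
        using nonzero[OF conv la las] nonzero[OF D s0 order_refl]
          quotient_bound_if_coefficient_bound[OF \<mu> N D s0 sp c B(2) bound[unfolded Sa, THEN conjunct1]
            bound[unfolded Sa, THEN conjunct2]]
        by blast
    qed
  qed
  show ?thesis
    using core by (auto simp: class_E_tilde_def class_X_def cong: conj_cong)
qed

theorem theorem6:
  fixes \<mu> \<gamma> A B :: real and k m :: nat
    and \<Phi> \<Psi> :: "complex \<Rightarrow> complex"
    and \<theta> l :: "nat \<Rightarrow> real"
    and f :: "nat \<Rightarrow> complex \<Rightarrow> complex"
    and F :: "complex \<Rightarrow> complex"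
  assumes "1 \<le> \<mu>" and "0 \<le> \<gamma>" and "\<gamma> < 1"
    and "-1 \<le> B" and "B < A" and "A \<le> 1" and "B < 0"
    and "m \<le> k"
    and "has_mu_series \<mu> \<Phi> (\<lambda>n. of_real (\<theta> n))"
    and "has_mu_series \<mu> \<Psi> (\<lambda>n. of_real (l n))"
    and "\<And>n. 2 \<le> n \<Longrightarrow> 0 \<le> \<theta> n"
    and "\<And>n. 2 \<le> n \<Longrightarrow> 0 \<le> l n"
    and "\<And>n. 2 \<le> n \<Longrightarrow> l n \<le> \<theta> n"
    and "\<And>n. 2 \<le> n \<Longrightarrow>
      (1 - B) * ((\<mu> * real n) ^ k * \<theta> n - (\<mu> * real n) ^ m * l n)
        + (A - B) * (1 - \<gamma>) * (\<mu> * real n) ^ m * l n \<noteq> 0"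
    and "\<And>z. norm z < 1 \<Longrightarrow> f 1 z = z"
    and "\<And>n z. 2 \<le> n \<Longrightarrow> norm z < 1 \<Longrightarrow>
      f n z = z - of_real ((A - B) * (1 - \<gamma>) /
          ((1 - B) * ((\<mu> * real n) ^ k * \<theta> n - (\<mu> * real n) ^ m * l n)
            + (A - B) * (1 - \<gamma>) * (\<mu> * real n) ^ m * l n))
        * z powr of_real (\<mu> * real n)"
  shows "F \<in> class_E_tilde k m \<Phi> \<Psi> A B \<mu> \<gamma> \<longleftrightarrow>
    (\<exists>\<eta> :: nat \<Rightarrow> real.
       (\<forall>n\<ge>1. 0 \<le> \<eta> n) \<and>
       (\<lambda>n. \<eta> (Suc n)) sums 1 \<and>
       (\<forall>z. norm z < 1 \<longrightarrow> (\<lambda>n. of_real (\<eta> (Suc n)) * f (Suc n) z) sums F z))"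
proof -
  define c where "c = (A - B) * (1 - \<gamma>)"
  define S where "S n = (1 - B) * ((\<mu> * real n) ^ k * \<theta> n - (\<mu> * real n) ^ m * l n)
        + (A - B) * (1 - \<gamma>) * (\<mu> * real n) ^ m * l n" for n
  have c: "0 < c" using assms(3,5) by (simp add: c_def)
  have S: "0 < S n" if "2 \<le> n" for n
  proof -
    have "1 \<le> \<mu> * real n"
      using mult_mono[of 1 \<mu> 1 "real n"] assms(1) that by simp
    then have pow: "(\<mu> * real n) ^ m \<le> (\<mu> * real n) ^ k" "0 \<le> (\<mu> * real n) ^ m"
      "0 \<le> (\<mu> * real n) ^ k"
      using power_increasing[OF \<open>m \<le> k\<close>, of "\<mu> * real n"] by auto
    then have "(\<mu> * real n) ^ m * l n \<le> (\<mu> * real n) ^ k * \<theta> n"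
      using assms(11-13) that by (intro mult_mono) auto
    then have "0 \<le> (1 - B) * ((\<mu> * real n) ^ k * \<theta> n - (\<mu> * real n) ^ m * l n)"
      using assms(7) by simp
    moreover have "0 \<le> c * (\<mu> * real n) ^ m * l n"
      using c pow assms(12) that by simp
    ultimately have "0 \<le> S n" by (simp add: S_def c_def)
    moreover have "S n \<noteq> 0" using assms(14)[OF that] by (simp add: S_def)
    ultimately show ?thesis by simp
  qed
  have f1: "f (Suc 0) z = z" if "norm z < 1" for z
    using assms(15)[OF that] by simp
  have fn: "f (Suc (Suc n)) z = z - of_real (c / S (n + 2)) * z powr of_real (\<mu> * real (n + 2))"
    if "norm z < 1" for n z
    using assms(16)[of "n + 2", OF _ that] by (simp add: S_def c_def)
  have "F \<in> class_E_tilde k m \<Phi> \<Psi> A B \<mu> \<gamma> \<longleftrightarrow>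
    (\<exists>a. (\<forall>n\<ge>2. 0 \<le> a n) \<and> has_mu_series \<mu> F (\<lambda>n. - of_real (a n)) \<and>
      summable (\<lambda>n. S (n + 2) * a (n + 2)) \<and> (\<Sum>n. S (n + 2) * a (n + 2)) \<le> c)"
    unfolding S_def c_def
    by (rule class_E_tilde_iff_coefficient_bound[OF assms(1,3,4,7,5,8-10,12,13)])
  also have "\<dots> \<longleftrightarrow> (\<exists>\<eta> :: nat \<Rightarrow> real.
       (\<forall>n\<ge>1. 0 \<le> \<eta> n) \<and>
       (\<lambda>n. \<eta> (Suc n)) sums 1 \<and>
       (\<forall>z. norm z < 1 \<longrightarrow> (\<lambda>n. of_real (\<eta> (Suc n)) * f (Suc n) z) sums F z))"
    (is "?coefficients \<longleftrightarrow> ?combination")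
  proof
    assume ?coefficients
    then obtain a where a: "\<forall>n\<ge>2. 0 \<le> a n" and F: "has_mu_series \<mu> F (\<lambda>n. - of_real (a n))"
      and sm: "summable (\<lambda>n. S (n + 2) * a (n + 2))"
      and le: "(\<Sum>n. S (n + 2) * a (n + 2)) \<le> c"
      by blast
    define t where "t = (\<Sum>n. S (n + 2) * a (n + 2)) / c"
    define \<eta> where "\<eta> n = (if n = 1 then 1 - t else S n * a n / c)" for n
    have t: "t \<le> 1" using le c by (simp add: t_def)
    have \<eta>0: "0 \<le> \<eta> n" if "1 \<le> n" for n
      using that t c a less_imp_le[OF S, of n] by (auto simp: \<eta>_def)
    have tail: "(\<lambda>n. \<eta> (Suc (Suc n))) sums t"
      using sums_divide[OF summable_sums[OF sm], of c] by (simp add: \<eta>_def t_def)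
    have "(\<lambda>n. \<eta> (Suc n)) sums 1"
      using sums_Suc[of "\<lambda>n. \<eta> (Suc n)", OF tail] by (simp add: \<eta>_def)
    moreover have "(\<lambda>n. of_real (\<eta> (Suc n)) * f (Suc n) z) sums F z" if z: "norm z < 1" for z
    proof -
      have "(\<lambda>n. of_real (\<eta> (Suc (Suc n))) * z
          + - of_real (a (n + 2)) * z powr of_real (\<mu> * real (n + 2))) sums (of_real t * z + (F z - z))"
        using F z unfolding has_mu_series_def
        by (intro sums_add sums_mult2 sums_of_real tail) blast
      moreover have "of_real (\<eta> (Suc (Suc n))) * z
          + - of_real (a (n + 2)) * z powr of_real (\<mu> * real (n + 2))
          = of_real (\<eta> (Suc (Suc n))) * f (Suc (Suc n)) z" for n
      proof -
        have "\<eta> (Suc (Suc n)) * (c / S (n + 2)) = a (n + 2)"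
          using S[of "n + 2"] c by (simp add: \<eta>_def)
        then have "of_real (\<eta> (Suc (Suc n))) * of_real (c / S (n + 2)) = complex_of_real (a (n + 2))"
          by (metis of_real_mult)
        then show ?thesis
          by (simp only: fn[OF z] right_diff_distrib mult.assoc[symmetric]) simp
      qed
      ultimately have "(\<lambda>n. of_real (\<eta> (Suc (Suc n))) * f (Suc (Suc n)) z)
          sums (of_real t * z + (F z - z))"
        by (simp only:)
      from sums_Suc[of "\<lambda>n. of_real (\<eta> (Suc n)) * f (Suc n) z", OF this]
      show ?thesis by (simp add: f1[OF z] \<eta>_def algebra_simps)
    qed
    ultimately show ?combination using \<eta>0 by blast
  next
    assume ?combination
    then obtain \<eta> :: "nat \<Rightarrow> real" where \<eta>0: "\<And>n. 1 \<le> n \<Longrightarrow> 0 \<le> \<eta> n"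
      and \<eta>1: "(\<lambda>n. \<eta> (Suc n)) sums 1"
      and F: "\<And>z. norm z < 1 \<Longrightarrow> (\<lambda>n. of_real (\<eta> (Suc n)) * f (Suc n) z) sums F z"
      by blast
    define a where "a n = \<eta> n * (c / S n)" for n
    have a: "\<forall>n\<ge>2. 0 \<le> a n"
      unfolding a_def using \<eta>0 c S by (intro allI impI mult_nonneg_nonneg divide_nonneg_pos) (auto intro: less_imp_le)
    have tail: "(\<lambda>n. \<eta> (Suc (Suc n))) sums (1 - \<eta> 1)"
      using \<eta>1 sums_Suc_iff[of "\<lambda>n. \<eta> (Suc n)" "1 - \<eta> 1"] by simp
    have "has_mu_series \<mu> F (\<lambda>n. - of_real (a n))"
      unfolding has_mu_series_def
    proof (intro allI impI)
      fix z :: complex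
      assume z: "norm z < 1"
      have "(\<lambda>n. of_real (\<eta> (Suc (Suc n))) * f (Suc (Suc n)) z) sums (F z - of_real (\<eta> 1) * z)"
        using F[OF z] sums_Suc_iff[of "\<lambda>n. of_real (\<eta> (Suc n)) * f (Suc n) z" "F z - of_real (\<eta> 1) * z"]
        by (simp add: f1[OF z])
      from sums_diff[OF this sums_mult2[OF sums_of_real[OF tail], of z]]
      have "(\<lambda>n. of_real (\<eta> (Suc (Suc n))) * f (Suc (Suc n)) z - of_real (\<eta> (Suc (Suc n))) * z)
          sums (F z - z)"
        by (simp add: algebra_simps)
      moreover have "of_real (\<eta> (Suc (Suc n))) * f (Suc (Suc n)) z - of_real (\<eta> (Suc (Suc n))) * z
          = - of_real (a (n + 2)) * z powr of_real (\<mu> * real (n + 2))" for n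
        by (simp only: fn[OF z] a_def right_diff_distrib of_real_mult) simp
      ultimately show "(\<lambda>n. - of_real (a (n + 2)) * z powr of_real (\<mu> * real (n + 2))) sums (F z - z)"
        by (simp only:)
    qed
    moreover have "(\<lambda>n. S (n + 2) * a (n + 2)) sums (c * (1 - \<eta> 1))"
    proof -
      have "S (n + 2) * a (n + 2) = c * \<eta> (Suc (Suc n))" for n
        using S[of "n + 2"] by (simp add: a_def)
      then show ?thesis using sums_mult[OF tail, of c] by (simp only:)
    qed
    moreover have "c * (1 - \<eta> 1) \<le> c"
      using c \<eta>0[of 1] by (simp add: algebra_simps)
    ultimately show ?coefficients
      using a by (auto simp: sums_iff intro!: exI[of _ a])
  qed
  finally show ?thesis .
qed

end
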